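(* A maximum induced matching in a labeled strongly biconvex graph can be computed in linear time: there is an algorithm which, given a strongly biconvex graph $H=(X,Y)$ with its labeling $X=\{x_q,\ldots,x_f\}$, $Y=\{y_{q'},\ldots,y_g\}$ together with the values $M(i)=\max\{t : \{x_i,y_t\}\in E(H)\}$ for all $i\in\{q,\ldots,f\}$ for which $x_i$ is not isolated, outputs an induced matching of $H$ of maximum size in time $O(|X|)$.
   Context: All graphs are finite and simple. Let $H=(X,Y)$ be a bipartite graph with bipartition $X\cup Y$, where $X=\{x_q,x_{q+1},\ldots,x_f\}$ and $Y=\{y_{q'},y_{q'+1},\ldots,y_g\}$ for some $q,q'\ge 1$. $H$ is called strongly biconvex (with respect to this labeling) if: (1) if $\{x_i,y_j\}\in E(H)$, then $i<j$; and (2) for any $r$ with $i<r<j$ and $\{x_i,y_j\}\in E(H)$: (i) if $x_r\in X$, then $\{x_r,y_j\}\in E(H)$; (ii) if $y_r\in Y$, then $\{x_i,y_r\}\in E(H)$. An induced matching of $H$ is a set of pairwise disjoint edges such that no endpoint of one of them is adjacent to an endpoint of another. Time is counted as the number of elementary operations (comparisons, arithmetic and look-ups of integer indices). *)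

theory Defs
  imports Complex_Main "HOL-Library.Landau_Symbols"
begin

section \<open>Labeled strongly biconvex graphs and induced matchings\<close>

text \<open>A graph is given by its vertex set and its set of edges, an edge being the set of its two
  endpoints. The vertices of a labeled graph are identified with their labels:
  \<open>vx i\<close> is $x_i$ and \<open>vy j\<close> is $y_j$. The two kinds of labels are distinct even for equal indices.\<close>

datatype vertex = vx nat | vy nat

definition bipartite_graph :: "'v set \<Rightarrow> 'v set \<Rightarrow> 'v set set \<Rightarrow> bool" where
  "bipartite_graph X Y E \<longleftrightarrow>
     finite X \<and> finite Y \<and> X \<inter> Y = {} \<and> (\<forall>e\<in>E. \<exists>x\<in>X. \<exists>y\<in>Y. e = {x, y})"

definition strongly_biconvex :: "vertex set \<Rightarrow> vertex set \<Rightarrow> vertex set set \<Rightarrow> bool" where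
  "strongly_biconvex X Y E \<longleftrightarrow>
     (\<forall>i j. {vx i, vy j} \<in> E \<longrightarrow> i < j) \<and>
     (\<forall>i j r. i < r \<and> r < j \<and> {vx i, vy j} \<in> E \<longrightarrow>
        (vx r \<in> X \<longrightarrow> {vx r, vy j} \<in> E) \<and>
        (vy r \<in> Y \<longrightarrow> {vx i, vy r} \<in> E))"

definition induced_matching :: "'v set set \<Rightarrow> 'v set set \<Rightarrow> bool" where
  "induced_matching E N \<longleftrightarrow>
     N \<subseteq> E \<and> pairwise (\<lambda>e e'. disjnt e e' \<and> (\<forall>u\<in>e. \<forall>v\<in>e'. {u, v} \<notin> E)) N"

text \<open>Cardinalities are only meaningful for finite \<open>E\<close>, which holds for every \<open>bipartite_graph\<close>.\<close>

definition maximum_induced_matching :: "'v set set \<Rightarrow> 'v set set \<Rightarrow> bool" where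
  "maximum_induced_matching E N \<longleftrightarrow>
     induced_matching E N \<and> (\<forall>N'. induced_matching E N' \<longrightarrow> card N' \<le> card N)"

definition isolated :: "'v set set \<Rightarrow> 'v \<Rightarrow> bool" where
  "isolated E v \<longleftrightarrow> (\<forall>e\<in>E. v \<notin> e)"

definition max_nbr :: "vertex set set \<Rightarrow> nat \<Rightarrow> nat" where
  "max_nbr E i = Max {t. {vx i, vy t} \<in> E}"


section \<open>Algorithms\<close>

text \<open>Algorithms are programs of a unit-cost random access machine in the form of a structured
  language over integer variables and integer arrays. A store assigns an integer to every variable
  and to every cell of every array. Among the arithmetic operations only addition and subtraction
  are available.\<close>

record store =
  vars :: "string \<Rightarrow> int"
  arrs :: "string \<Rightarrow> int \<Rightarrow> int"

datatype exp =
    Const int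
  | Var string
  | Add exp exp
  | Sub exp exp
  | Lookup string exp

datatype test = Less exp exp | Equal exp exp

datatype com =
    Skip
  | Assign string exp
  | Store string exp exp
  | Seq com com
  | Cond test com com
  | While test com

primrec val :: "exp \<Rightarrow> store \<Rightarrow> int" where
  "val (Const n) s = n"
| "val (Var v) s = vars s v"
| "val (Add a b) s = val a s + val b s"
| "val (Sub a b) s = val a s - val b s"
| "val (Lookup A a) s = arrs s A (val a s)"

primrec holds :: "test \<Rightarrow> store \<Rightarrow> bool" where
  "holds (Less a b) s \<longleftrightarrow> val a s < val b s"
| "holds (Equal a b) s \<longleftrightarrow> val a s = val b s"

text \<open>Every constant, variable access, arithmetic operation, array look-up, comparison and
  elementary command costs one unit.\<close>

primrec exp_cost :: "exp \<Rightarrow> nat" where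
  "exp_cost (Const n) = 1"
| "exp_cost (Var v) = 1"
| "exp_cost (Add a b) = exp_cost a + exp_cost b + 1"
| "exp_cost (Sub a b) = exp_cost a + exp_cost b + 1"
| "exp_cost (Lookup A a) = exp_cost a + 1"

primrec test_cost :: "test \<Rightarrow> nat" where
  "test_cost (Less a b) = exp_cost a + exp_cost b + 1"
| "test_cost (Equal a b) = exp_cost a + exp_cost b + 1"

text \<open>\<open>exec c s t s'\<close>: started in store \<open>s\<close>, the command \<open>c\<close> terminates after exactly \<open>t\<close> units
  of time in store \<open>s'\<close>.\<close>

inductive exec :: "com \<Rightarrow> store \<Rightarrow> nat \<Rightarrow> store \<Rightarrow> bool" where
  exec_Skip: "exec Skip s 1 s"
| exec_Assign: "exec (Assign v a) s (exp_cost a + 1) (s\<lparr>vars := (vars s)(v := val a s)\<rparr>)"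
| exec_Store: "exec (Store A a b) s (exp_cost a + exp_cost b + 1)
    (s\<lparr>arrs := (arrs s)(A := (arrs s A)(val a s := val b s))\<rparr>)"
| exec_Seq: "exec c s t s' \<Longrightarrow> exec d s' t' s'' \<Longrightarrow> exec (Seq c d) s (t + t') s''"
| exec_Cond_True: "holds b s \<Longrightarrow> exec c s t s' \<Longrightarrow> exec (Cond b c d) s (test_cost b + t) s'"
| exec_Cond_False: "\<not> holds b s \<Longrightarrow> exec d s t s' \<Longrightarrow> exec (Cond b c d) s (test_cost b + t) s'"
| exec_While_True: "holds b s \<Longrightarrow> exec c s t s' \<Longrightarrow> exec (While b c) s' t' s'' \<Longrightarrow>
    exec (While b c) s (test_cost b + t + t') s''"
| exec_While_False: "\<not> holds b s \<Longrightarrow> exec (While b c) s (test_cost b) s"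

inductive_cases exec_SkipE: "exec Skip s t s'"
inductive_cases exec_AssignE: "exec (Assign v a) s t s'"
inductive_cases exec_StoreE: "exec (Store A a b) s t s'"
inductive_cases exec_SeqE: "exec (Seq c d) s t s'"
inductive_cases exec_CondE: "exec (Cond b c d) s t s'"
inductive_cases exec_WhileE: "exec (While b c) s t s'"

lemma exec_deterministic: "exec c s t s' \<Longrightarrow> exec c s u r \<Longrightarrow> u = t \<and> r = s'"
proof (induction arbitrary: u r rule: exec.induct)
  case exec_Skip
  then show ?case by (auto elim: exec_SkipE)
next
  case exec_Assign
  then show ?case by (auto elim: exec_AssignE)
next
  case exec_Store
  then show ?case by (auto elim: exec_StoreE)
next
  case exec_Seq
  from exec_Seq.prems show ?case by (rule exec_SeqE) (use exec_Seq.IH in blast)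
next
  case exec_Cond_True
  from exec_Cond_True.prems show ?case
    by (rule exec_CondE) (use exec_Cond_True.IH exec_Cond_True.hyps in blast)+
next
  case exec_Cond_False
  from exec_Cond_False.prems show ?case
    by (rule exec_CondE) (use exec_Cond_False.IH exec_Cond_False.hyps in blast)+
next
  case exec_While_True
  from exec_While_True.prems show ?case
    by (rule exec_WhileE) (use exec_While_True.IH exec_While_True.hyps in blast)+
next
  case exec_While_False
  from exec_While_False.prems show ?case
    by (rule exec_WhileE) (use exec_While_False.hyps in blast)+
qed


section \<open>Input and output\<close>

text \<open>A labeled strongly biconvex graph is presented to an algorithm by the bounds of its labels
  and the array of the values \<open>max_nbr E i\<close>, with $x_i$ occupying cell \<open>i\<close>. These data determine the
  graph, as the neighbours of a non-isolated $x_i$ are the $y_j$ with \<open>i < j \<le> max_nbr E i\<close>. An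
  isolated $x_i$ has no such value, which is marked by the number 0: this is not the index of
  a vertex, as labels start from 1. All remaining memory is 0.\<close>

definition input :: "nat \<Rightarrow> nat \<Rightarrow> nat \<Rightarrow> nat \<Rightarrow> vertex set set \<Rightarrow> store" where
  "input q f q' g E = \<lparr>
     vars = (\<lambda>_. 0)(''q'' := int q, ''f'' := int f, ''q1'' := int q', ''g'' := int g),
     arrs = (\<lambda>_ _. 0)(''M'' := (\<lambda>z.
       if int q \<le> z \<and> z \<le> int f \<and> \<not> isolated E (vx (nat z)) then int (max_nbr E (nat z)) else 0))\<rparr>"

text \<open>The output is the list of the first \<open>k\<close> entries of the two arrays \<open>X\<close> and \<open>Y\<close>, read as pairs of
  labels. Negative entries are read as 0 and hence never denote a vertex of the graph.\<close>

definition output_edges :: "store \<Rightarrow> vertex set list" where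
  "output_edges s = map (\<lambda>l. {vx (nat (arrs s ''X'' (int l))), vy (nat (arrs s ''Y'' (int l)))})
     [0..<nat (vars s ''k'')]"

end

theory Submission
  imports Defs
begin

text \<open>
  In a strongly biconvex graph the neighbourhood of a non-isolated \<open>x\<^sub>i\<close> is the set of all \<open>y\<^sub>j\<close>
  in \<open>Y\<close> with \<open>i < j \<le> M i\<close>, where \<open>M i\<close> is the largest index of a neighbour, and \<open>M\<close> is monotone
  on the indices of non-isolated vertices. Consequently two edges
  \<open>(a, b)\<close> and \<open>(c, d)\<close> (written as pairs of labels) with \<open>a < c\<close> can occur together in an induced
  matching exactly if \<open>b \<le> c\<close> and \<open>M a < d\<close>: the edge \<open>x\<^sub>c y\<^sub>b\<close> can only be excluded by
  \<open>b \<le> c\<close>, since \<open>b \<le> M a \<le> M c\<close>, and the edge \<open>x\<^sub>a y\<^sub>d\<close> only by \<open>M a < d\<close>, since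
  \<open>a < c < d\<close>.

  So the effect of the edges chosen so far on later ones is captured by two thresholds, the last
  \<open>y\<close>-index \<open>b\<close> and the value \<open>m\<close> of \<open>M\<close> at the last \<open>x\<close>-index: a further edge \<open>(c, d)\<close> needs
  \<open>c \<ge> b\<close> and \<open>d > m\<close>, and smaller thresholds are better. The smallest \<open>c \<ge> b\<close> with
  \<open>M c > m\<close>, together with the smallest \<open>d\<close> allowed for it, which is \<open>max c m + 1\<close>, minimises
  both new thresholds at once. Hence the greedy choice is optimal; the exchange argument is
  \<open>length_greedy_upper_bound\<close>. It needs a single scan of the \<open>x\<close>-indices with a constant amount of
  work for each (\<open>exec_scan\<close>).
\<close>

section \<open>Adjacency and compatible edges in strongly biconvex graphs\<close>

definition pair_edge :: "nat \<times> nat \<Rightarrow> vertex set" where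
  "pair_edge p = {vx (fst p), vy (snd p)}"

lemma inj_pair_edge: "inj pair_edge"
  by (auto simp: inj_def pair_edge_def doubleton_eq_iff)

definition pairs_of :: "vertex set set \<Rightarrow> (nat \<times> nat) set" where
  "pairs_of N = {p. pair_edge p \<in> N}"

locale labeled_strongly_biconvex =
  fixes q f q' g :: nat and E :: "vertex set set"
  assumes q'_pos: "q' \<ge> 1"
    and bip: "bipartite_graph (vx ` {q..f}) (vy ` {q'..g}) E"
    and biconvex: "strongly_biconvex (vx ` {q..f}) (vy ` {q'..g}) E"
begin

abbreviation adj :: "nat \<Rightarrow> nat \<Rightarrow> bool" where
  "adj i j \<equiv> {vx i, vy j} \<in> E"

text \<open>The largest index of a neighbour of \<open>x\<^sub>i\<close>, with the same default 0 for isolated vertices as in the input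
  array. A scan that only takes indices with \<open>reach i > m\<close> thus skips them without a test of its own.\<close>

definition reach :: "nat \<Rightarrow> nat" where
  "reach i = (if isolated E (vx i) then 0 else max_nbr E i)"

lemma edgeE:
  assumes "e \<in> E"
  obtains p where "e = pair_edge p"
  using assms bip unfolding bipartite_graph_def pair_edge_def
  by (metis (no_types, lifting) fst_conv image_iff snd_conv)

lemma adj_range:
  assumes "adj i j"
  shows "q \<le> i" "i \<le> f" "q' \<le> j" "j \<le> g"
proof -
  obtain x y where "x \<in> vx ` {q..f}" "y \<in> vy ` {q'..g}" "{vx i, vy j} = {x, y}"
    using assms bip unfolding bipartite_graph_def by meson
  then show "q \<le> i" "i \<le> f" "q' \<le> j" "j \<le> g"
    by (auto simp: doubleton_eq_iff)
qed

lemma adj_less: "adj i j \<Longrightarrow> i < j"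
  using biconvex unfolding strongly_biconvex_def by blast

lemma adj_not_isolated: "adj i j \<Longrightarrow> \<not> isolated E (vx i)"
  unfolding isolated_def by blast

lemma finite_nbrs: "finite {t. adj i t}"
  by (rule finite_subset[of _ "{..g}"]) (auto dest: adj_range)

lemma adj_le_reach: "adj i j \<Longrightarrow> j \<le> reach i"
  using Max_ge[OF finite_nbrs, of j i] by (simp add: reach_def max_nbr_def adj_not_isolated)

lemma adj_reach:
  assumes "reach i > 0"
  shows "adj i (reach i)"
proof -
  have ni: "\<not> isolated E (vx i)"
    using assms by (auto simp: reach_def split: if_splits)
  then obtain e where "e \<in> E" "vx i \<in> e"
    unfolding isolated_def by blast
  moreover from this obtain p where "e = pair_edge p"
    by (auto elim: edgeE)
  ultimately have "{t. adj i t} \<noteq> {}"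
    by (auto simp: pair_edge_def)
  with finite_nbrs have "Max {t. adj i t} \<in> {t. adj i t}"
    by (rule Max_in)
  with ni show ?thesis
    by (simp add: reach_def max_nbr_def)
qed

lemma adj_iff: "adj i j \<longleftrightarrow> i < j \<and> q' \<le> j \<and> j \<le> reach i"
proof
  assume r: "i < j \<and> q' \<le> j \<and> j \<le> reach i"
  then have a: "adj i (reach i)"
    by (intro adj_reach) auto
  show "adj i j"
  proof (cases "j = reach i")
    case False
    moreover have "vy j \<in> vy ` {q'..g}"
      using r adj_range[OF a] by auto
    ultimately show ?thesis
      using a r biconvex unfolding strongly_biconvex_def by (metis le_neq_implies_less)
  qed (use a in simp)
qed (use adj_less adj_range adj_le_reach in blast)

text \<open>If \<open>reach i \<le> k\<close>, then \<open>reach k\<close> exceeds \<open>k\<close>, as every edge goes up; otherwise \<open>k\<close> lies below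
  the edge from \<open>i\<close> to \<open>reach i\<close>, and biconvexity makes it a neighbour of \<open>reach i\<close> too.\<close>

lemma reach_mono:
  assumes "reach i > 0" "reach k > 0" "i \<le> k"
  shows "reach i \<le> reach k"
proof (cases "i < k \<and> k < reach i")
  case True
  have "vx k \<in> vx ` {q..f}"
    using adj_range[OF adj_reach[OF assms(2)]] by auto
  then have "adj k (reach i)"
    using True adj_reach[OF assms(1)] biconvex unfolding strongly_biconvex_def by blast
  then show ?thesis by (rule adj_le_reach)
next
  case False
  then show ?thesis
    using assms(3) adj_less[OF adj_reach[OF assms(2)]] by (cases "i = k") auto
qed

text \<open>The relation between two edges of an induced matching, the first with the smaller \<open>x\<close>-index,
  that rules out both crossing edges. Unlike the condition on induced matchings, it is expressed by
  two comparisons that involve the first edge only through two numbers.\<close>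

definition precedes :: "nat \<times> nat \<Rightarrow> nat \<times> nat \<Rightarrow> bool" where
  "precedes p p' \<longleftrightarrow> snd p \<le> fst p' \<and> reach (fst p) < snd p'"

lemma precedes_imp_induced:
  assumes "pair_edge p \<in> E" "pair_edge p' \<in> E" "precedes p p'"
  shows "disjnt (pair_edge p) (pair_edge p') \<and>
    (\<forall>u\<in>pair_edge p. \<forall>v\<in>pair_edge p'. {u, v} \<notin> E \<and> {v, u} \<notin> E)"
proof -
  obtain a b c d where p: "p = (a, b)" "p' = (c, d)" by fastforce
  have ab: "a < b" "b \<le> reach a" and cd: "c < d" and s: "b \<le> c" "reach a < d"
    using assms by (auto simp: p pair_edge_def precedes_def adj_iff)
  have same_side: "{vx i, vx j} \<notin> E" "{vy i, vy j} \<notin> E" for i j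
    by (metis edgeE pair_edge_def doubleton_eq_iff vertex.distinct(1))+
  have "\<not> adj a d" "\<not> adj c b"
    using s by (auto simp: adj_iff)
  moreover have "{y, x} = {x, y}" for x y :: vertex
    by (rule insert_commute)
  moreover have "a \<noteq> c" "b \<noteq> d"
    using ab cd s by auto
  ultimately show ?thesis
    using same_side by (simp add: p pair_edge_def disjnt_def)
qed

lemma induced_imp_precedes:
  assumes "induced_matching E N" "p \<in> pairs_of N" "p' \<in> pairs_of N" "fst p < fst p'"
  shows "precedes p p'"
proof -
  obtain a b c d where p: "p = (a, b)" "p' = (c, d)" by fastforce
  have N: "pair_edge p \<in> N" "pair_edge p' \<in> N" "N \<subseteq> E"
    using assms by (auto simp: pairs_of_def induced_matching_def)
  have "pair_edge p \<noteq> pair_edge p'"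
    using assms(4) by (auto dest: injD[OF inj_pair_edge])
  with N assms(1) have "\<forall>u\<in>pair_edge p. \<forall>v\<in>pair_edge p'. {u, v} \<notin> E"
    unfolding induced_matching_def pairwise_def by blast
  then have n: "\<not> adj a d" "\<not> adj c b"
    by (auto simp: p pair_edge_def insert_commute)
  have e: "adj a b" "adj c d"
    using N by (auto simp: p pair_edge_def)
  have "reach a \<le> reach c"
    using e assms(4) by (intro reach_mono) (auto simp: adj_iff p)
  then show ?thesis
    using n e assms(4) by (auto simp: adj_iff p precedes_def)
qed

lemma induced_fst_eq:
  assumes "induced_matching E N" "p \<in> pairs_of N" "p' \<in> pairs_of N" "fst p = fst p'"
  shows "p = p'"
proof (rule ccontr)
  assume "p \<noteq> p'"
  then have "pair_edge p \<noteq> pair_edge p'"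
    by (auto dest: injD[OF inj_pair_edge])
  with assms have "disjnt (pair_edge p) (pair_edge p')"
    unfolding induced_matching_def pairwise_def pairs_of_def by blast
  with assms(4) show False
    by (auto simp: pair_edge_def disjnt_def)
qed

lemma finite_pairs_of:
  assumes "N \<subseteq> E"
  shows "finite (pairs_of N)"
proof (rule finite_subset)
  show "pairs_of N \<subseteq> {q..f} \<times> {q'..g}"
  proof
    fix p assume "p \<in> pairs_of N"
    then have "adj (fst p) (snd p)"
      using assms by (auto simp: pairs_of_def pair_edge_def)
    then show "p \<in> {q..f} \<times> {q'..g}"
      using adj_range by (auto simp: mem_Times_iff)
  qed
qed simp

lemma card_pairs_of:
  assumes "N \<subseteq> E"
  shows "card (pairs_of N) = card N"
proof -
  have "N = pair_edge ` pairs_of N"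
    using assms by (auto simp: pairs_of_def elim: edgeE)
  then show ?thesis
    by (metis card_image inj_on_subset inj_pair_edge subset_UNIV)
qed

lemma induced_matching_if_sorted:
  assumes "sorted_wrt precedes ps" "\<forall>p\<in>set ps. pair_edge p \<in> E"
  shows "induced_matching E (pair_edge ` set ps)"
proof -
  have "disjnt (pair_edge p) (pair_edge p') \<and> (\<forall>u\<in>pair_edge p. \<forall>v\<in>pair_edge p'. {u, v} \<notin> E)"
    if p: "p \<in> set ps" "p' \<in> set ps" "pair_edge p \<noteq> pair_edge p'" for p p'
  proof -
    obtain i j where ij: "i < length ps" "j < length ps" "p = ps ! i" "p' = ps ! j"
      using p by (auto simp: in_set_conv_nth)
    with p(3) have "i < j \<or> j < i"
      by (metis linorder_neqE_nat)
    then have "precedes p p' \<or> precedes p' p"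
      using ij assms(1) by (auto simp: sorted_wrt_iff_nth_less)
    then show ?thesis
      using p assms(2) precedes_imp_induced[of p p'] precedes_imp_induced[of p' p] disjnt_sym
      by metis
  qed
  then show ?thesis
    using assms(2) unfolding induced_matching_def pairwise_def by blast
qed

section \<open>The greedy induced matching\<close>

text \<open>The thresholds \<open>b\<close> and \<open>m\<close> record what the edges chosen before impose on the next one. Because
  edges go up, \<open>max i m + 1\<close> is the first index above \<open>m\<close> to which \<open>x\<^sub>i\<close> can be joined.\<close>

primrec greedy :: "nat list \<Rightarrow> nat \<Rightarrow> nat \<Rightarrow> (nat \<times> nat) list" where
  "greedy [] b m = []"
| "greedy (i # is) b m =
     (if b \<le> i \<and> m < reach i then (i, max i m + 1) # greedy is (max i m + 1) (reach i)
      else greedy is b m)"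

text \<open>The hypothesis \<open>q' \<le> m + 1\<close> makes \<open>max i m + 1\<close> an index of \<open>Y\<close>: the left end of \<open>Y\<close> is
  treated as if an earlier edge had blocked all smaller indices.\<close>

lemma greedy_sound:
  assumes "q' \<le> m + 1"
  shows "sorted_wrt precedes (greedy is b m) \<and>
    (\<forall>p\<in>set (greedy is b m). pair_edge p \<in> E \<and> b \<le> fst p \<and> m < snd p)"
  using assms
proof (induction "is" arbitrary: b m)
  case (Cons i "is")
  show ?case
  proof (cases "b \<le> i \<and> m < reach i")
    case True
    have a: "adj i (reach i)"
      using True by (intro adj_reach) auto
    have "adj i (max i m + 1)"
      using True Cons.prems adj_less[OF a] by (auto simp: adj_iff)
    moreover have "q' \<le> reach i + 1"
      using True Cons.prems by simp
    note IH = Cons.IH[OF this, of "max i m + 1"]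
    ultimately show ?thesis
      using True by (fastforce simp: precedes_def pair_edge_def)
  qed (use Cons in auto)
qed simp

text \<open>Removing from a competing matching its first edge leaves edges that respect the thresholds
  set by the first greedy edge, because no admissible edge has a smaller end or a smaller reach than
  the greedy one. So a greedy step loses at most one edge of the competitor.\<close>

lemma length_greedy_upper_bound:
  assumes "sorted_wrt (<) is" "finite P"
    and "\<And>p. p \<in> P \<Longrightarrow> pair_edge p \<in> E \<and> fst p \<in> set is \<and> b \<le> fst p \<and> m < snd p"
    and "\<And>p p'. p \<in> P \<Longrightarrow> p' \<in> P \<Longrightarrow> fst p < fst p' \<Longrightarrow> precedes p p'"
    and "inj_on fst P"
  shows "card P \<le> length (greedy is b m)"
  using assms
proof (induction "is" arbitrary: b m P)
  case Nil
  then have "P = {}" by fastforce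
  then show ?case by simp
next
  case (Cons i "is")
  have srt: "sorted_wrt (<) is" and i_less: "\<And>j. j \<in> set is \<Longrightarrow> i < j"
    using Cons.prems(1) by auto
  have P_adj: "fst p < snd p" "snd p \<le> reach (fst p)" if "p \<in> P" for p
    using Cons.prems(3)[OF that] by (auto simp: pair_edge_def adj_iff)
  show ?case
  proof (cases "b \<le> i \<and> m < reach i")
    case False
    have "fst p \<noteq> i" if "p \<in> P" for p
      using False P_adj[OF that] Cons.prems(3)[OF that] by auto
    then have "card P \<le> length (greedy is b m)"
      using Cons.prems by (intro Cons.IH[OF srt]) auto
    then show ?thesis using False by auto
  next
    case True
    show ?thesis
    proof (cases "P = {}")
      case nonempty: False
      obtain p0 where p0: "p0 \<in> P" and least: "\<And>p. p \<in> P \<Longrightarrow> fst p0 \<le> fst p"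
        using ex_min_if_finite[of "fst ` P"] nonempty Cons.prems(2)
        by (metis (no_types, lifting) finite_imageI image_iff image_is_empty not_le)
      have i_p0: "i \<le> fst p0"
        using Cons.prems(3)[OF p0] i_less by (auto intro: less_imp_le)
      have reach_le: "reach i \<le> reach (fst p0)"
        using True i_p0 P_adj[OF p0] by (intro reach_mono) auto
      let ?P = "P - {p0}"
      \<comment> \<open>Since \<open>i < snd p0\<close> and \<open>m < snd p0\<close>, the greedy end \<open>max i m + 1\<close> is at most \<open>snd p0\<close>.\<close>
      have rest: "pair_edge p \<in> E \<and> fst p \<in> set is \<and> max i m + 1 \<le> fst p \<and> reach i < snd p"
        if p: "p \<in> ?P" for p
      proof -
        have "fst p0 < fst p"
          using least[of p] p p0 Cons.prems(5) by (auto dest: inj_onD intro: le_neq_implies_less)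
        moreover from this have "precedes p0 p"
          using Cons.prems(4) p p0 by blast
        ultimately show ?thesis
          using Cons.prems(3)[of p] Cons.prems(3)[OF p0] P_adj[OF p0] p i_p0 reach_le
          by (auto simp: precedes_def)
      qed
      have "card ?P \<le> length (greedy is (max i m + 1) (reach i))"
        using Cons.prems rest by (intro Cons.IH[OF srt]) (auto intro: inj_on_subset)
      moreover have "card P = Suc (card ?P)"
        using p0 Cons.prems(2) by (rule card.remove[rotated])
      ultimately show ?thesis using True by simp
    qed simp
  qed
qed

theorem greedy_maximum:
  defines "ps \<equiv> greedy [q..<Suc f] 0 (q' - 1)"
  shows "distinct (map pair_edge ps) \<and> maximum_induced_matching E (set (map pair_edge ps))"
proof -
  have sound: "sorted_wrt precedes ps" "\<forall>p\<in>set ps. pair_edge p \<in> E"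
    using greedy_sound[of "q' - 1" "[q..<Suc f]" 0] by (auto simp: ps_def)
  have "sorted_wrt (\<lambda>p p'. p \<noteq> p') ps"
  proof (rule sorted_wrt_mono_rel[OF _ sound(1)])
    fix p p' assume "p \<in> set ps" "p' \<in> set ps" "precedes p p'"
    then show "p \<noteq> p'"
      using sound(2) adj_less by (fastforce simp: pair_edge_def precedes_def)
  qed
  then have dist: "distinct ps"
    by (simp add: distinct_conv_nth sorted_wrt_iff_nth_less) (metis linorder_neqE_nat)
  then have dist': "distinct (map pair_edge ps)"
    by (simp add: distinct_map inj_on_subset[OF inj_pair_edge])
  have "card N \<le> length ps" if N: "induced_matching E N" for N
  proof -
    have NE: "N \<subseteq> E"
      using N by (simp add: induced_matching_def)
    have "card (pairs_of N) \<le> length ps"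
      unfolding ps_def
    proof (rule length_greedy_upper_bound)
      show "pair_edge p \<in> E \<and> fst p \<in> set [q..<Suc f] \<and> 0 \<le> fst p \<and> q' - 1 < snd p"
        if "p \<in> pairs_of N" for p
        using that NE q'_pos adj_range[of "fst p" "snd p"]
        by (auto simp: pairs_of_def pair_edge_def)
      show "inj_on fst (pairs_of N)"
        using induced_fst_eq[OF N] by (auto intro: inj_onI)
      show "sorted_wrt (<) [q..<Suc f]"
        by (rule sorted_wrt_upt)
    qed (use induced_imp_precedes[OF N] finite_pairs_of[OF NE] in auto)
    then show ?thesis
      by (simp add: card_pairs_of[OF NE])
  qed
  moreover have "card (set (map pair_edge ps)) = length ps"
    using distinct_card[OF dist'] by simp
  ultimately show ?thesis
    using dist' induced_matching_if_sorted[OF sound] by (simp add: maximum_induced_matching_def)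
qed

end

section \<open>Execution of loop-free commands\<close>

primrec loop_free :: "com \<Rightarrow> bool" where
  "loop_free Skip \<longleftrightarrow> True"
| "loop_free (Assign v a) \<longleftrightarrow> True"
| "loop_free (Store A a b) \<longleftrightarrow> True"
| "loop_free (Seq c d) \<longleftrightarrow> loop_free c \<and> loop_free d"
| "loop_free (Cond b c d) \<longleftrightarrow> loop_free c \<and> loop_free d"
| "loop_free (While b c) \<longleftrightarrow> False"

text \<open>The values at loops are dummies; all uses are restricted to \<open>loop_free\<close> commands.\<close>

primrec effect :: "com \<Rightarrow> store \<Rightarrow> store" where
  "effect Skip s = s"
| "effect (Assign v a) s = s\<lparr>vars := (vars s)(v := val a s)\<rparr>"
| "effect (Store A a b) s = s\<lparr>arrs := (arrs s)(A := (arrs s A)(val a s := val b s))\<rparr>"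
| "effect (Seq c d) s = effect d (effect c s)"
| "effect (Cond b c d) s = (if holds b s then effect c s else effect d s)"
| "effect (While b c) s = s"

primrec worst_cost :: "com \<Rightarrow> nat" where
  "worst_cost Skip = 1"
| "worst_cost (Assign v a) = exp_cost a + 1"
| "worst_cost (Store A a b) = exp_cost a + exp_cost b + 1"
| "worst_cost (Seq c d) = worst_cost c + worst_cost d"
| "worst_cost (Cond b c d) = test_cost b + max (worst_cost c) (worst_cost d)"
| "worst_cost (While b c) = 0"

lemma exec_loop_free:
  "loop_free c \<Longrightarrow> \<exists>t. exec c s t (effect c s) \<and> t \<le> worst_cost c"
proof (induction c arbitrary: s)
  case Skip
  then show ?case using exec_Skip by force
next
  case (Assign v a)
  then show ?case using exec_Assign by force
next
  case (Store A a b)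
  then show ?case using exec_Store by force
next
  case (Seq c d)
  then obtain t t' where "exec c s t (effect c s)" "t \<le> worst_cost c"
    "exec d (effect c s) t' (effect d (effect c s))" "t' \<le> worst_cost d"
    by force
  then show ?case
    by (auto intro!: exI[of _ "t + t'"] exec_Seq)
next
  case (Cond b c d)
  show ?case
  proof (cases "holds b s")
    case True
    obtain t where "exec c s t (effect c s)" "t \<le> worst_cost c"
      using Cond by force
    then show ?thesis
      using True by (auto intro!: exI[of _ "test_cost b + t"] exec_Cond_True)
  next
    case False
    obtain t where "exec d s t (effect d s)" "t \<le> worst_cost d"
      using Cond by force
    then show ?thesis
      using False by (auto intro!: exI[of _ "test_cost b + t"] exec_Cond_False)
  qed
qed simp

section \<open>The linear-time program\<close>

definition select_edge :: com where
  "select_edge =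
     Seq (Cond (Less (Var ''i'') (Var ''m''))
           (Assign ''b'' (Add (Var ''m'') (Const 1)))
           (Assign ''b'' (Add (Var ''i'') (Const 1))))
     (Seq (Store ''X'' (Var ''k'') (Var ''i''))
     (Seq (Store ''Y'' (Var ''k'') (Var ''b''))
     (Seq (Assign ''k'' (Add (Var ''k'') (Const 1)))
          (Assign ''m'' (Lookup ''M'' (Var ''i''))))))"

definition scan_step :: com where
  "scan_step =
     Seq (Cond (Less (Var ''i'') (Var ''b'')) Skip
           (Cond (Less (Var ''m'') (Lookup ''M'' (Var ''i''))) select_edge Skip))
         (Assign ''i'' (Add (Var ''i'') (Const 1)))"

definition scan :: com where
  "scan = While (Less (Var ''i'') (Add (Var ''f'') (Const 1))) scan_step"

text \<open>The variables \<open>b\<close> and \<open>k\<close> start correctly from the 0 found in unused memory.\<close>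

definition initialize :: com where
  "initialize =
     Seq (Assign ''i'' (Var ''q'')) (Assign ''m'' (Sub (Var ''q1'') (Const 1)))"

definition greedy_program :: com where
  "greedy_program = Seq initialize scan"

lemma loop_free_parts: "loop_free scan_step" "loop_free initialize"
  by (simp_all add: scan_step_def select_edge_def initialize_def)

definition stored_pairs :: "store \<Rightarrow> (nat \<times> nat) list \<Rightarrow> bool" where
  "stored_pairs s ps \<longleftrightarrow> vars s ''k'' = int (length ps) \<and>
     (\<forall>l<length ps. arrs s ''X'' (int l) = int (fst (ps ! l)) \<and>
                    arrs s ''Y'' (int l) = int (snd (ps ! l)))"

lemma output_edges_stored_pairs:
  "stored_pairs s ps \<Longrightarrow> output_edges s = map pair_edge ps"
  by (auto simp: stored_pairs_def output_edges_def pair_edge_def intro!: nth_equalityI)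

context labeled_strongly_biconvex
begin

definition scanning :: "nat \<Rightarrow> nat \<Rightarrow> nat \<Rightarrow> store \<Rightarrow> bool" where
  "scanning i b m s \<longleftrightarrow> vars s ''i'' = int i \<and> vars s ''b'' = int b \<and> vars s ''m'' = int m \<and>
     vars s ''f'' = int f \<and> (\<forall>j\<in>{q..f}. arrs s ''M'' (int j) = int (reach j))"

lemma scanning_effect_scan_step:
  assumes "scanning i b m s" "stored_pairs s ps" "q \<le> i" "i \<le> f"
  shows "if b \<le> i \<and> m < reach i
    then scanning (Suc i) (max i m + 1) (reach i) (effect scan_step s) \<and>
         stored_pairs (effect scan_step s) (ps @ [(i, max i m + 1)])
    else scanning (Suc i) b m (effect scan_step s) \<and> stored_pairs (effect scan_step s) ps"
  using assms
  by (auto simp: scanning_def stored_pairs_def scan_step_def select_edge_def nth_append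
      max_def less_Suc_eq)

text \<open>Each iteration is charged for its body and the 5 units of the loop test; the final 5 units
  are those of the last, failing test.\<close>

lemma exec_scan:
  assumes "scanning i b m s" "stored_pairs s ps" "q \<le> i"
  shows "\<exists>t s'. exec scan s t s' \<and> t \<le> (Suc f - i) * (worst_cost scan_step + 5) + 5 \<and>
    stored_pairs s' (ps @ greedy [i..<Suc f] b m)"
  using assms
proof (induction "Suc f - i" arbitrary: i b m s ps)
  case 0
  then have "exec scan s (test_cost (Less (Var ''i'') (Add (Var ''f'') (Const 1)))) s"
    unfolding scan_def by (intro exec_While_False) (auto simp: scanning_def)
  with 0 show ?case
    by (intro exI[of _ 5] exI[of _ s]) (auto simp: eval_nat_numeral)
next
  case (Suc n)
  from Suc.hyps have "i \<le> f" by simp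
  then have upt: "[i..<Suc f] = i # [Suc i..<Suc f]"
    by (simp add: upt_conv_Cons)
  let ?s = "effect scan_step s"
  let ?pick = "b \<le> i \<and> m < reach i"
  let ?b = "if ?pick then max i m + 1 else b" and ?m = "if ?pick then reach i else m"
  let ?ps = "if ?pick then ps @ [(i, max i m + 1)] else ps"
  have step: "scanning (Suc i) ?b ?m ?s" "stored_pairs ?s ?ps"
    using scanning_effect_scan_step[OF Suc.prems \<open>i \<le> f\<close>] by (auto split: if_splits)
  obtain t1 where t1: "exec scan_step s t1 ?s" "t1 \<le> worst_cost scan_step"
    using exec_loop_free loop_free_parts(1) by blast
  have rest: "n = Suc f - Suc i" "q \<le> Suc i"
    using Suc.hyps(2) Suc.prems(3) by auto
  obtain t2 s' where t2: "exec scan ?s t2 s'" "t2 \<le> (Suc f - Suc i) * (worst_cost scan_step + 5) + 5"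
    and out: "stored_pairs s' (?ps @ greedy [Suc i..<Suc f] ?b ?m)"
    using Suc.hyps(1)[OF _ step] rest by blast
  have "holds (Less (Var ''i'') (Add (Var ''f'') (Const 1))) s"
    using Suc.prems(1) \<open>i \<le> f\<close> by (simp add: scanning_def)
  from exec_While_True[OF this t1(1) t2(1)[unfolded scan_def]]
  have "exec scan s (5 + t1 + t2) s'"
    by (simp add: scan_def eval_nat_numeral)
  moreover have "5 + t1 + t2 \<le> (Suc f - i) * (worst_cost scan_step + 5) + 5"
    using t1(2) t2(2) \<open>i \<le> f\<close> by (simp add: Suc_diff_le)
  moreover have "?ps @ greedy [Suc i..<Suc f] ?b ?m = ps @ greedy [i..<Suc f] b m"
    unfolding upt by (simp del: upt_Suc)
  ultimately show ?case
    using out by metis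
qed

lemma exec_greedy_program:
  "\<exists>t s. exec greedy_program (input q f q' g E) t s \<and>
     t \<le> worst_cost initialize + (Suc f - q) * (worst_cost scan_step + 5) + 5 \<and>
     stored_pairs s (greedy [q..<Suc f] 0 (q' - 1))"
proof -
  let ?s = "effect initialize (input q f q' g E)"
  have "scanning q 0 (q' - 1) ?s" "stored_pairs ?s []"
    using q'_pos by (auto simp: scanning_def stored_pairs_def initialize_def input_def reach_def)
  from exec_scan[OF this order_refl] obtain t s where
    "exec scan ?s t s" "t \<le> (Suc f - q) * (worst_cost scan_step + 5) + 5"
    "stored_pairs s (greedy [q..<Suc f] 0 (q' - 1))"
    by (auto simp del: upt_Suc)
  moreover obtain t0 where "exec initialize (input q f q' g E) t0 ?s" "t0 \<le> worst_cost initialize"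
    using exec_loop_free loop_free_parts(2) by blast
  ultimately show ?thesis
    unfolding greedy_program_def
    by (intro exI[of _ "t0 + t"] exI[of _ s]) (auto intro: exec_Seq)
qed

end

theorem corollary2p7:
  "\<exists>(P :: com) (T :: nat \<Rightarrow> nat).
     (\<lambda>n. real (T n)) \<in> O(\<lambda>n. real n) \<and>
     (\<forall>(q :: nat) (f :: nat) (q' :: nat) (g :: nat) (X :: vertex set) (Y :: vertex set) (E :: vertex set set).
        q \<ge> 1 \<and> q' \<ge> 1 \<and> X = vx ` {q..f} \<and> Y = vy ` {q'..g} \<and>
        bipartite_graph X Y E \<and> strongly_biconvex X Y E \<longrightarrow>
        (\<exists>t s. exec P (input q f q' g E) t s \<and> t \<le> T (card X) \<and>
           distinct (output_edges s) \<and> maximum_induced_matching E (set (output_edges s))))"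
proof -
  let ?T = "\<lambda>n. worst_cost initialize + n * (worst_cost scan_step + 5) + 5"
  \<comment> \<open>For \<open>n \<ge> 1\<close> the additive constants are at most \<open>n\<close> times themselves, hence the factor \<open>?T 1\<close>.\<close>
  have "(\<lambda>n. real (?T n)) \<in> O(\<lambda>n. real n)"
  proof (rule bigoI)
    show "\<forall>\<^sub>F n in at_top. norm (real (?T n)) \<le> real (?T 1) * norm (real n)"
    proof (intro eventually_mono[OF eventually_ge_at_top[of 1]])
      fix n :: nat assume "1 \<le> n"
      then have "?T n \<le> ?T 1 * n"
        by (simp add: algebra_simps add_mono)
      then show "norm (real (?T n)) \<le> real (?T 1) * norm (real n)"
        by (metis norm_of_nat of_nat_le_iff of_nat_mult)
    qed
  qed
  moreover have "\<exists>t s. exec greedy_program (input q f q' g E) t s \<and> t \<le> ?T (card X) \<and>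
      distinct (output_edges s) \<and> maximum_induced_matching E (set (output_edges s))"
    if "q \<ge> 1 \<and> q' \<ge> 1 \<and> X = vx ` {q..f} \<and> Y = vy ` {q'..g} \<and>
        bipartite_graph X Y E \<and> strongly_biconvex X Y E" for q f q' g X Y E
  proof -
    interpret labeled_strongly_biconvex q f q' g E
      using that by unfold_locales auto
    have "card X = Suc f - q"
      using that by (simp add: card_image inj_on_def)
    moreover obtain t s where "exec greedy_program (input q f q' g E) t s"
      "t \<le> worst_cost initialize + (Suc f - q) * (worst_cost scan_step + 5) + 5"
      "stored_pairs s (greedy [q..<Suc f] 0 (q' - 1))"
      using exec_greedy_program by blast
    moreover from this(3) have
      "output_edges s = map pair_edge (greedy [q..<Suc f] 0 (q' - 1))"
      by (rule output_edges_stored_pairs)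
    ultimately show ?thesis
      using greedy_maximum by (intro exI[of _ t] exI[of _ s]) (simp del: upt_Suc)
  qed
  ultimately show ?thesis
    by (intro exI[of _ greedy_program] exI[of _ ?T] conjI allI impI)
qed

end
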